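(* Let $A$, $B$ and $C$ be integers with $A \geq 2$, $B \geq 1$ and $C \geq 1$, and let $p>3$ be a prime. For any integers $m \geq 1$ and $r \geq 1$, we have $$D(mp^r, A, B, C) \equiv D(mp^{r-1}, A, B, C) \pmod{p^{3r}},$$ where for a non-negative integer $n$, $$D(n, A, B, C) := \sum_{k=0}^{n} \binom{n}{k}^{A} \binom{2k}{k}^B \binom{2(n-k)}{n-k}^C.$$
   Context: The numbers $D(n,A,B,C)$ are called generalized Domb numbers; the case $A=2$, $B=C=1$ gives the Domb numbers $D(n)=\sum_{k=0}^{n} \binom{n}{k}^{2} \binom{2k}{k} \binom{2(n-k)}{n-k}$. *)

theory Defs
  imports "HOL-Number_Theory.Number_Theory"
begin

definition gen_domb :: "nat \<Rightarrow> nat \<Rightarrow> nat \<Rightarrow> nat \<Rightarrow> nat" where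
  "gen_domb n A B C =
     (\<Sum>k = 0..n. (n choose k) ^ A * ((2 * k) choose k) ^ B * ((2 * (n - k)) choose (n - k)) ^ C)"

end

theory Submission
  imports Defs
begin

text \<open>The congruence holds termwise. Let \<open>T(n,k)\<close> be the \<open>k\<close>-th summand of \<open>D(n)\<close>. The product of its
  two central binomials is divisible by \<open>n choose k\<close>, because the super Catalan numbers
  \<open>(2k)! (2l)! / (k! l! (k + l)!)\<close> are integers; hence \<open>(n choose k) ^ 3\<close> divides \<open>T(n,k)\<close>. Now let
  \<open>n = m p ^ r\<close>, and let \<open>s \<le> r\<close> be maximal such that \<open>p ^ s\<close> divides \<open>k\<close>. Then \<open>p ^ (r - s)\<close> divides
  \<open>n choose k\<close>, which settles the terms with \<open>s = 0\<close>. If \<open>s \<ge> 1\<close>, the same power divides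
  \<open>(n/p) choose (k/p)\<close>, and the missing factor \<open>p ^ (3 s)\<close> comes from a Jacobsthal-type
  congruence: if \<open>p ^ s\<close> divides \<open>p a\<close> and \<open>p b\<close>, then \<open>p a choose p b\<close> divided by \<open>a choose b\<close> is
  congruent to \<open>1\<close> modulo \<open>p ^ (3 s)\<close>, so \<open>T(n,k) \<equiv> T(n/p,k/p)\<close> modulo \<open>p ^ (3 r)\<close>.\<close>

section \<open>Factorials without their multiples of p\<close>

lemma prime_imp_coprime_left:
  fixes p i :: nat
  assumes "prime p" "\<not> p dvd i"
  shows "coprime i p"
  using prime_imp_coprime[OF assms] by (rule coprime_imp_coprime) auto

text \<open>For prime \<open>p\<close> this is, up to sign, Morita's p-adic gamma function at
  \<open>n + 1\<close>.\<close>

definition unit_fact :: "nat \<Rightarrow> nat \<Rightarrow> int" where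
  "unit_fact p n = (\<Prod>i\<in>{i\<in>{1..n}. \<not> p dvd i}. int i)"

lemma coprime_unit_fact:
  assumes "prime p"
  shows "coprime (unit_fact p n) (int p)"
  unfolding unit_fact_def
proof (rule prod_coprime_left)
  fix i assume "i \<in> {i\<in>{1..n}. \<not> p dvd i}"
  then show "coprime (int i) (int p)"
    using assms by (simp add: prime_imp_coprime_left)
qed

text \<open>The multiples of \<open>p\<close> contribute \<open>p ^ n * n!\<close>. In a quotient of
  binomials these parts cancel, so only products of units have to be compared.\<close>

lemma fact_prime_mult:
  assumes "p > 0"
  shows "fact (p * n) = int p ^ n * fact n * unit_fact p (p * n)"
proof -
  have eq: "{1..p * n} = (*) p ` {1..n} \<union> {i\<in>{1..p * n}. \<not> p dvd i}"
    using assms by (auto simp: image_iff)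
  have "fact (p * n) = (\<Prod>i\<in>{1..p * n}. int i)"
    by (simp add: fact_prod)
  also have "\<dots> = (\<Prod>i\<in>(*) p ` {1..n}. int i) * unit_fact p (p * n)"
    unfolding unit_fact_def by (subst eq, rule prod.union_disjoint) auto
  also have "(\<Prod>i\<in>(*) p ` {1..n}. int i) = (\<Prod>i\<in>{1..n}. int p * int i)"
    using assms by (subst prod.reindex) (auto simp: inj_on_def)
  also have "\<dots> = int p ^ n * fact n"
    by (simp add: prod.distrib fact_prod)
  finally show ?thesis .
qed

lemma unit_fact_add_block:
  assumes "p dvd c"
  shows "unit_fact p (c + q) = unit_fact p c * (\<Prod>i\<in>{i\<in>{1..q}. \<not> p dvd i}. int c + int i)"
proof -
  let ?U = "{i\<in>{1..q}. \<not> p dvd i}"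
  have eq: "{i\<in>{1..c + q}. \<not> p dvd i} = {i\<in>{1..c}. \<not> p dvd i} \<union> (+) c ` ?U"
  proof (intro equalityI subsetI)
    fix i assume i: "i \<in> {i\<in>{1..c + q}. \<not> p dvd i}"
    show "i \<in> {i\<in>{1..c}. \<not> p dvd i} \<union> (+) c ` ?U"
    proof (cases "i \<le> c")
      case False
      then have i': "i = c + (i - c)" by simp
      then have "\<not> p dvd i - c" using i assms dvd_add[of p c "i - c"] by auto
      then have "i - c \<in> ?U" using i False by auto
      with i' have "i \<in> (+) c ` ?U" by (rule image_eqI)
      then show ?thesis by blast
    qed (use i in auto)
  qed (use assms in \<open>auto simp: dvd_add_right_iff\<close>)
  have "unit_fact p (c + q) = unit_fact p c * (\<Prod>i\<in>(+) c ` ?U. int i)"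
    unfolding unit_fact_def by (subst eq, rule prod.union_disjoint) auto
  also have "(\<Prod>i\<in>(+) c ` ?U. int i) = (\<Prod>i\<in>?U. int c + int i)"
    by (subst prod.reindex) (auto simp: inj_on_def)
  finally show ?thesis .
qed

section \<open>Products of units over blocks of length p^e\<close>

text \<open>This is the Taylor expansion to first order at \<open>y = 0\<close>: the sum is the
  derivative of the product.\<close>

lemma prod_add_cong_square:
  fixes w :: "'a \<Rightarrow> int"
  assumes "finite A"
  shows "[(\<Prod>i\<in>A. y + w i) = (\<Prod>i\<in>A. w i) + y * (\<Sum>i\<in>A. \<Prod>j\<in>A - {i}. w j)] (mod y\<^sup>2)"
  using assms
proof (induction A rule: finite_induct)
  case (insert a A)
  let ?S = "\<Sum>i\<in>A. \<Prod>j\<in>A - {i}. w j"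
  have "(\<Prod>j\<in>insert a A - {i}. w j) = w a * (\<Prod>j\<in>A - {i}. w j)" if "i \<in> A" for i
  proof -
    have "insert a A - {i} = insert a (A - {i})" using that insert by auto
    then show ?thesis using insert by simp
  qed
  moreover have "insert a A - {a} = A" using insert by auto
  ultimately have S: "(\<Sum>i\<in>insert a A. \<Prod>j\<in>insert a A - {i}. w j) = (\<Prod>i\<in>A. w i) + w a * ?S"
    using insert by (simp add: sum_distrib_left)
  have "[(y + w a) * (\<Prod>i\<in>A. y + w i) = (y + w a) * ((\<Prod>i\<in>A. w i) + y * ?S)] (mod y\<^sup>2)"
    using insert.IH by (rule cong_scalar_left)
  also have "(y + w a) * ((\<Prod>i\<in>A. w i) + y * ?S) =
      w a * (\<Prod>i\<in>A. w i) + y * ((\<Prod>i\<in>A. w i) + w a * ?S) + y\<^sup>2 * ?S"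
    by (simp add: algebra_simps power2_eq_square)
  also have "[\<dots> = w a * (\<Prod>i\<in>A. w i) + y * ((\<Prod>i\<in>A. w i) + w a * ?S)] (mod y\<^sup>2)"
    by (simp add: cong_iff_dvd_diff)
  finally show ?case using insert S by simp
qed simp

text \<open>Up to a unit the sum is \<open>-\<Sum> 1/i\<^sup>2\<close> over the units modulo \<open>q = p ^ e\<close>. Doubling permutes
  the units, so the sum equals a quarter of itself, and \<open>3\<close> is invertible.\<close>

lemma sum_prod_units_cong_0:
  fixes p e :: nat
  assumes p: "prime p" "p > 3" and e: "e \<ge> 1"
  defines "q \<equiv> p ^ e"
  defines "U \<equiv> {i\<in>{1..q}. \<not> p dvd i}"
  shows "[(\<Sum>i\<in>U. \<Prod>j\<in>U - {i}. int j * (int q - int j)) = 0] (mod int q)"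
proof -
  define w where "w i = int i * (int q - int i)" for i
  define W where "W i = (\<Prod>j\<in>U - {i}. w j)" for i
  define \<sigma> where "\<sigma> i = (2 * i) mod q" for i
  have fin: "finite U" by (simp add: U_def)
  have pq: "p dvd q" using e by (simp add: q_def dvd_power)
  have q0: "q > 0" using p by (simp add: q_def)
  have cop: "coprime (int i) (int q)" if "i \<in> U" for i
    using that p unfolding U_def q_def by (auto simp: prime_imp_coprime_left)
  have not2: "\<not> p dvd 2" using p by (auto dest: dvd_imp_le)
  have copn: "coprime 2 q"
    using p prime_odd_nat[of p] unfolding q_def by simp
  have less: "i < q" if "i \<in> U" for i
    using that pq unfolding U_def by (cases "i = q") auto
  have \<sigma>U: "\<sigma> i \<in> U" if "i \<in> U" for i
  proof -
    have "\<not> p dvd i" using that by (simp add: U_def)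
    then have "\<not> p dvd 2 * i" using p not2 prime_dvd_mult_nat by blast
    then have nd: "\<not> p dvd \<sigma> i" using pq unfolding \<sigma>_def by (simp add: dvd_mod_iff)
    moreover have "\<sigma> i \<noteq> 0" using nd by (intro notI) simp
    moreover have "\<sigma> i < q" using q0 by (simp add: \<sigma>_def)
    ultimately show ?thesis by (simp add: U_def)
  qed
  have inj: "inj_on \<sigma> U"
  proof (rule inj_onI)
    fix i j assume ij: "i \<in> U" "j \<in> U" "\<sigma> i = \<sigma> j"
    then have "[2 * i = 2 * j] (mod q)" by (simp add: \<sigma>_def cong_def)
    then have "[i = j] (mod q)" using copn cong_mult_lcancel_nat by blast
    then show "i = j" using less ij by (simp add: cong_def)
  qed
  have bij: "bij_betw \<sigma> U U"
    using inj \<sigma>U fin by (simp add: bij_betw_def endo_inj_surj image_subsetI)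
  have wW: "w i * W i = (\<Prod>j\<in>U. w j)" if "i \<in> U" for i
    using that fin unfolding W_def by (simp add: prod.remove)
  \<comment> \<open>Modulo \<open>q\<close>, \<open>w i\<close> is \<open>- i * i\<close>, so
    doubling \<open>i\<close> multiplies it by 4.\<close>
  have w\<sigma>: "[w (\<sigma> i) = 4 * w i] (mod int q)" if "i \<in> U" for i
  proof -
    have "[int (\<sigma> i) = 2 * int i] (mod int q)"
      by (simp add: \<sigma>_def cong_def zmod_int)
    then have "[int (\<sigma> i) * (0 - int (\<sigma> i)) = 2 * int i * (0 - 2 * int i)] (mod int q)"
      by (intro cong_mult cong_diff) auto
    moreover have "[w j = int j * (0 - int j)] (mod int q)" for j
      unfolding w_def by (intro cong_mult cong_diff) (auto simp: cong_def)
    ultimately have "[w (\<sigma> i) = 2 * int i * (0 - 2 * int i)] (mod int q)"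
      using cong_trans by blast
    also have "2 * int i * (0 - 2 * int i) = 4 * (int i * (0 - int i))" by simp
    also have "[\<dots> = 4 * w i] (mod int q)"
      using \<open>\<And>j. [w j = int j * (0 - int j)] (mod int q)\<close> by (intro cong_scalar_left) (rule cong_sym)
    finally show ?thesis .
  qed
  \<comment> \<open>Both \<open>w i * W i\<close> and \<open>w (\<sigma> i) * W (\<sigma> i)\<close>
    are the full product over \<open>U\<close>; replace \<open>w (\<sigma> i)\<close> by
    \<open>4 * w i\<close> and cancel the unit \<open>w i\<close>.\<close>
  have 4: "[4 * W (\<sigma> i) = W i] (mod int q)" if i: "i \<in> U" for i
  proof -
    have "coprime (w i) (int q)"
    proof -
      have "coprime (int q - int i) (int q)"
        by (rule cong_imp_coprime[of "- int i"]) (use cop[OF i] in \<open>auto simp: cong_iff_dvd_diff\<close>)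
      then show ?thesis using cop[OF i] by (simp add: w_def)
    qed
    moreover have "[w i * (4 * W (\<sigma> i)) = w i * W i] (mod int q)"
    proof -
      have "[4 * w i * W (\<sigma> i) = w (\<sigma> i) * W (\<sigma> i)] (mod int q)"
        using w\<sigma>[OF i] by (intro cong_scalar_right) (rule cong_sym)
      then show ?thesis using wW[OF i] wW[OF \<sigma>U[OF i]] by (simp add: mult_ac)
    qed
    ultimately show ?thesis using cong_mult_lcancel by blast
  qed
  have "[4 * (\<Sum>i\<in>U. W i) = (\<Sum>i\<in>U. W i)] (mod int q)"
  proof -
    have "4 * (\<Sum>i\<in>U. W i) = (\<Sum>i\<in>U. 4 * W (\<sigma> i))"
      using sum.reindex_bij_betw[OF bij, of W] by (simp flip: sum_distrib_left)
    also have "[\<dots> = (\<Sum>i\<in>U. W i)] (mod int q)" by (rule cong_sum) (rule 4)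
    finally show ?thesis .
  qed
  then have "int q dvd 3 * (\<Sum>i\<in>U. W i)" by (simp add: cong_iff_dvd_diff)
  moreover have "coprime (int q) 3"
  proof -
    have "\<not> p dvd 3" using p by (auto dest: dvd_imp_le)
    then have "coprime p 3" using p by (simp add: prime_imp_coprime)
    then have "coprime q 3" by (simp add: q_def)
    then have "coprime (int q) (int 3)" by (subst coprime_int_iff)
    then show ?thesis by simp
  qed
  ultimately have "int q dvd (\<Sum>i\<in>U. W i)" by (simp add: coprime_dvd_mult_right_iff)
  then show ?thesis by (simp add: cong_0_iff W_def w_def)
qed

text \<open>Pairing \<open>i\<close> with \<open>q - i\<close> shows that the square of the product is a function of
  \<open>x * (x + q)\<close>, which is divisible by \<open>q\<^sup>2\<close>.\<close>

lemma prod_units_shift_cong: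
  fixes p e :: nat and x :: int
  assumes p: "prime p" "p > 3" and e: "e \<ge> 1"
  defines "q \<equiv> p ^ e"
  defines "U \<equiv> {i\<in>{1..q}. \<not> p dvd i}"
  assumes x: "int q dvd x"
  shows "[(\<Prod>i\<in>U. x + int i) = (\<Prod>i\<in>U. int i)] (mod int q ^ 3)"
proof -
  define f where "f z = (\<Prod>i\<in>U. z + int i)" for z :: int
  define w where "w i = int i * (int q - int i)" for i
  define S where "S = (\<Sum>i\<in>U. \<Prod>j\<in>U - {i}. w j)"
  have fin: "finite U" by (simp add: U_def)
  have pq: "p dvd q" using e by (simp add: q_def dvd_power)
  have less: "i < q" if "i \<in> U" for i
    using that pq unfolding U_def by (cases "i = q") auto
  have refl: "q - i \<in> U" if "i \<in> U" for i
  proof -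
    have "\<not> p dvd q - i"
      using that pq less[OF that] by (auto simp: U_def dest: dvd_diffD1)
    then show ?thesis using less[OF that] by (auto simp: U_def)
  qed
  have bij: "bij_betw (\<lambda>i. q - i) U U"
    by (rule bij_betwI[where g = "\<lambda>i. q - i"]) (use refl less[THEN less_imp_le] in auto)
  \<comment> \<open>Each pair gives
    \<open>(z + i) * (z + q - i) = z * (z + q) + i * (q - i)\<close>.\<close>
  have sq: "(f z)\<^sup>2 = (\<Prod>i\<in>U. z * (z + int q) + w i)" for z
  proof -
    have "f z = (\<Prod>i\<in>U. z + int (q - i))"
      unfolding f_def by (rule prod.reindex_bij_betw[OF bij, symmetric])
    also have "\<dots> = (\<Prod>i\<in>U. z + (int q - int i))"
      using less by (intro prod.cong) (auto simp: of_nat_diff less_imp_le)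
    finally have "(f z)\<^sup>2 = (\<Prod>i\<in>U. (z + int i) * (z + (int q - int i)))"
      by (simp add: power2_eq_square prod.distrib) (simp add: f_def)
    then show ?thesis by (simp add: w_def algebra_simps)
  qed
  have w0: "(\<Prod>i\<in>U. w i) = (f 0)\<^sup>2" using sq[of 0] by simp
  obtain c where c: "x = int q * c" using x by blast
  define y where "y = x * (x + int q)"
  have y: "y = int q ^ 2 * (c * (c + 1))"
    by (simp add: y_def c algebra_simps power2_eq_square)
  \<comment> \<open>Since \<open>q ^ 2\<close> divides \<open>y\<close>, terms of order two in
    \<open>y\<close> vanish modulo \<open>q ^ 3\<close>. The linear term vanishes as well, because
    \<open>q\<close> divides \<open>S\<close>.\<close>
  have "int q ^ 3 dvd y\<^sup>2"
  proof -
    have "y\<^sup>2 = int q ^ 3 * (int q * (c * (c + 1))\<^sup>2)"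
      by (simp add: y power2_eq_square power3_eq_cube algebra_simps)
    then show ?thesis by simp
  qed
  moreover have "[(f x)\<^sup>2 = (f 0)\<^sup>2 + y * S] (mod y\<^sup>2)"
    using prod_add_cong_square[OF fin, of y w] sq[of x] w0 by (simp add: S_def y_def)
  ultimately have "[(f x)\<^sup>2 = (f 0)\<^sup>2 + y * S] (mod int q ^ 3)"
    using cong_dvd_modulus by blast
  moreover have "[y * S = 0] (mod int q ^ 3)"
  proof -
    have "int q dvd S"
      using sum_prod_units_cong_0[OF p e] by (simp add: S_def w_def U_def q_def cong_0_iff)
    then have "int q ^ 2 * int q dvd y * S" unfolding y by (intro mult_dvd_mono) auto
    then show ?thesis by (simp add: cong_0_iff power3_eq_cube power2_eq_square mult_ac)
  qed
  ultimately have "[(f x)\<^sup>2 = (f 0)\<^sup>2] (mod int q ^ 3)"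
    by (metis add.right_neutral cong_add_lcancel cong_trans)
  then have d: "int q ^ 3 dvd (f x + f 0) * (f x - f 0)"
    by (simp add: cong_iff_dvd_diff power2_eq_square algebra_simps)
  \<comment> \<open>Equal squares leave open the sign. Modulo \<open>p\<close> the sum
    \<open>f x + f 0\<close> is the unit \<open>2 * f 0\<close>, so it can be cancelled and the sign
    is plus.\<close>
  have "coprime (int q ^ 3) (f x + f 0)"
  proof -
    have "int p dvd x" using x pq by (meson dvd_trans int_dvd_int_iff)
    then have "[x = 0] (mod int p)" by (simp add: cong_0_iff)
    then have "[f x = f 0] (mod int p)"
      unfolding f_def by (intro cong_prod cong_add) auto
    then have "[f x + f 0 = 2 * f 0] (mod int p)"
      by (simp add: cong_iff_dvd_diff)
    moreover have "coprime (2 * f 0) (int p)"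
    proof -
      have "coprime 2 (int p)" using p prime_odd_nat[of p] by simp
      then show ?thesis
        using coprime_unit_fact[OF p(1), of q] by (simp add: f_def unit_fact_def U_def)
    qed
    ultimately have "coprime (f x + f 0) (int p)"
      using cong_imp_coprime cong_sym by blast
    then show ?thesis by (simp add: q_def coprime_commute)
  qed
  then have "int q ^ 3 dvd f x - f 0" using d coprime_dvd_mult_right_iff by blast
  then show ?thesis by (simp add: cong_iff_dvd_diff f_def)
qed

text \<open>The units up to \<open>c * p ^ e\<close> form \<open>c\<close> blocks, each a translate
  of the first by a multiple of \<open>p ^ e\<close>; such a translation preserves the product
  modulo \<open>p ^ (3 * e)\<close>.\<close>

lemma unit_fact_mult_cong:
  fixes p e :: nat
  assumes p: "prime p" "p > 3" and e: "e \<ge> 1"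
  shows "[unit_fact p (c * p ^ e) = unit_fact p (p ^ e) ^ c] (mod int p ^ (3 * e))"
proof (induction c)
  case 0
  then show ?case by (simp add: unit_fact_def)
next
  case (Suc c)
  have "p dvd c * p ^ e" using e by (simp add: dvd_power)
  then have "unit_fact p (Suc c * p ^ e) = unit_fact p (c * p ^ e) *
      (\<Prod>i\<in>{i\<in>{1..p ^ e}. \<not> p dvd i}. int (c * p ^ e) + int i)"
    using unit_fact_add_block[of p "c * p ^ e" "p ^ e"] by (simp add: add.commute)
  also have "[\<dots> = unit_fact p (p ^ e) ^ c * unit_fact p (p ^ e)] (mod int p ^ (3 * e))"
  proof (rule cong_mult[OF Suc])
    show "[(\<Prod>i\<in>{i\<in>{1..p ^ e}. \<not> p dvd i}. int (c * p ^ e) + int i) = unit_fact p (p ^ e)]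
        (mod int p ^ (3 * e))"
      using prod_units_shift_cong[OF p e, of "int (c * p ^ e)"]
      by (simp add: unit_fact_def power_mult[symmetric] mult.commute)
  qed
  finally show ?case by (simp add: mult.commute)
qed

section \<open>Ratios of binomial coefficients modulo powers of p\<close>

text \<open>For nonzero \<open>y\<close> this says that \<open>x / y\<close> is a \<open>p\<close>-adic integer congruent to \<open>1\<close> modulo \<open>p ^ M\<close>.\<close>

definition ratio_cong_1 :: "nat \<Rightarrow> nat \<Rightarrow> int \<Rightarrow> int \<Rightarrow> bool" where
  "ratio_cong_1 p M x y \<longleftrightarrow>
     (\<exists>P Q. coprime Q (int p) \<and> [P = Q] (mod int p ^ M) \<and> x * Q = y * P)"

lemma ratio_cong_1_mult:
  assumes "ratio_cong_1 p M x y" "ratio_cong_1 p M x' y'"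
  shows "ratio_cong_1 p M (x * x') (y * y')"
proof -
  obtain P Q P' Q' where
    "coprime Q (int p)" "[P = Q] (mod int p ^ M)" "x * Q = y * P"
    "coprime Q' (int p)" "[P' = Q'] (mod int p ^ M)" "x' * Q' = y' * P'"
    using assms unfolding ratio_cong_1_def by blast
  moreover from this have "(x * x') * (Q * Q') = (y * y') * (P * P')"
    by (metis mult.assoc mult.left_commute)
  ultimately show ?thesis
    unfolding ratio_cong_1_def by (meson cong_mult coprime_mult_left_iff)
qed

lemma ratio_cong_1_power:
  assumes "ratio_cong_1 p M x y"
  shows "ratio_cong_1 p M (x ^ n) (y ^ n)"
proof (induction n)
  case 0
  show ?case unfolding ratio_cong_1_def by (intro exI[of _ 1]) simp
qed (simp add: ratio_cong_1_mult assms)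

text \<open>From \<open>x * Q = y * P\<close> follows \<open>Q * (x - y) = y * (P - Q)\<close>: the
  powers of \<open>p\<close> in \<open>y\<close> and \<open>P - Q\<close> multiply, and the unit
  \<open>Q\<close> cancels.\<close>

lemma ratio_cong_1_imp_cong:
  assumes "ratio_cong_1 p M x y" "int p ^ t dvd y"
  shows "[x = y] (mod int p ^ (t + M))"
proof -
  obtain P Q where PQ: "coprime Q (int p)" "[P = Q] (mod int p ^ M)" "x * Q = y * P"
    using assms unfolding ratio_cong_1_def by blast
  have "int p ^ t * int p ^ M dvd y * (P - Q)"
    using assms PQ by (intro mult_dvd_mono) (auto simp: cong_iff_dvd_diff)
  also have "y * (P - Q) = Q * (x - y)" using PQ by (simp add: algebra_simps)
  finally have "int p ^ (t + M) dvd x - y"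
    using PQ by (simp add: power_add[symmetric] coprime_dvd_mult_right_iff coprime_commute)
  then show ?thesis by (simp add: cong_iff_dvd_diff)
qed

text \<open>After the multiples of \<open>p\<close> are split off all three factorials, the ratio is
  \<open>P / Q\<close> with products of units. If \<open>p * b\<close> and \<open>p * d\<close> are
  \<open>u\<close> and \<open>v\<close> times \<open>p ^ e\<close>, then \<open>P\<close> and
  \<open>Q\<close> are both congruent to \<open>unit_fact p (p ^ e) ^ (u + v)\<close>.\<close>

lemma binomial_ratio_cong_1:
  fixes p e a b :: nat
  assumes p: "prime p" "p > 3" and e: "e \<ge> 1"
    and a: "p ^ e dvd p * a" and b: "p ^ e dvd p * b" and le: "b \<le> a"
  shows "ratio_cong_1 p (3 * e) (int (p * a choose (p * b))) (int (a choose b))"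
proof -
  obtain d where d: "a = b + d" using le le_Suc_ex by blast
  have p0: "p > 0" using p by simp
  have pd: "p ^ e dvd p * d" using a b by (simp add: d algebra_simps dvd_add_right_iff)
  obtain u v where u: "p * b = u * p ^ e" and v: "p * d = v * p ^ e"
    using b pd by (metis dvd_div_mult_self)
  let ?F = "unit_fact p"
  define Q where "Q = ?F (p * b) * ?F (p * d)"
  define P where "P = ?F (p * a)"
  have "coprime Q (int p)" using coprime_unit_fact[OF p(1)] by (simp add: Q_def)
  moreover have "[P = Q] (mod int p ^ (3 * e))"
  proof -
    have "P = ?F ((u + v) * p ^ e)" by (simp add: P_def d u v distrib_left distrib_right)
    also have "[\<dots> = ?F (p ^ e) ^ (u + v)] (mod int p ^ (3 * e))"
      by (rule unit_fact_mult_cong[OF p e])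
    also have "[?F (p ^ e) ^ (u + v) = Q] (mod int p ^ (3 * e))"
      unfolding Q_def u v power_add
      by (intro cong_mult cong_sym[OF unit_fact_mult_cong[OF p e]])
    finally show ?thesis .
  qed
  moreover have "int (p * a choose (p * b)) * Q = int (a choose b) * P"
  proof -
    \<comment> \<open>\<open>K\<close> clears the denominators; it is nonzero and is cancelled at
      the end.\<close>
    define K where "K = int p ^ a * (fact b * fact d)"
    have "int (p * a choose (p * b)) * Q * K = int (p * a choose (p * b)) * (fact (p * b) * fact (p * d))"
      unfolding Q_def K_def d power_add fact_prime_mult[OF p0] by (simp only: mult_ac)
    also have "\<dots> = fact (p * a)"
      using binomial_fact_lemma[of "p * b" "p * a", THEN arg_cong[where f = int]]
      by (simp add: d distrib_left mult_ac)
    also have "\<dots> = int p ^ a * P * fact a"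
      by (simp add: P_def fact_prime_mult[OF p0])
    also have "fact a = int (a choose b) * (fact b * fact d)"
      using binomial_fact_lemma[of b a, THEN arg_cong[where f = int]]
      by (simp add: d mult_ac)
    finally have "int (p * a choose (p * b)) * Q * K = int (a choose b) * P * K"
      by (simp add: K_def mult_ac)
    moreover have "K \<noteq> 0" using p0 by (simp add: K_def)
    ultimately show ?thesis by simp
  qed
  ultimately show ?thesis unfolding ratio_cong_1_def by blast
qed

section \<open>Super Catalan numbers\<close>

text \<open>The integrality of the super Catalan numbers \<open>S(k,l)\<close>, by \<open>S(k,l+1) = 4 S(k,l) - S(k+1,l)\<close>.\<close>

lemma super_catalan_Ints:
  "fact (2 * k) * fact (2 * l) / (fact k * fact l * fact (k + l)) \<in> (\<int> :: real set)"
proof (induction l arbitrary: k)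
  case 0
  have "fact (2 * k) / (fact k * fact k) = (of_nat (2 * k choose k) :: real)"
    by (subst binomial_fact) auto
  then show ?case by (simp add: mult.commute)
next
  case (Suc l)
  let ?S = "\<lambda>k l. fact (2 * k) * fact (2 * l) / (fact k * fact l * fact (k + l)) :: real"
  define X where "X = ?S k l"
  have dbl: "fact (2 * Suc n) = (2 * real (Suc n)) * real (2 * n + 1) * (fact (2 * n) :: real)" for n
    by (simp add: algebra_simps)
  have nz: "real (Suc k) \<noteq> 0" "real (Suc l) \<noteq> 0" "real (Suc (k + l)) \<noteq> 0" by simp_all
  have "?S (Suc k) l = 2 * real (2 * k + 1) / real (Suc (k + l)) * X"
    unfolding X_def dbl using nz by (simp add: divide_simps del: of_nat_Suc)
  moreover have "?S k (Suc l) = 2 * real (2 * l + 1) / real (Suc (k + l)) * X"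
    unfolding X_def dbl using nz by (simp add: divide_simps del: of_nat_Suc)
  \<comment> \<open>The factors leading from \<open>S(k,l)\<close> to its two neighbours add up to
    4, which is the recursion. It raises \<open>k\<close>, so \<open>k\<close> has to be arbitrary
    in the induction.\<close>
  moreover have "2 * real (2 * k + 1) / real (Suc (k + l)) + 2 * real (2 * l + 1) / real (Suc (k + l)) = 4"
    by (simp add: divide_simps)
  ultimately have "?S k (Suc l) = 4 * X - ?S (Suc k) l"
    by (metis (no_types, lifting) add_diff_cancel_left' distrib_right)
  moreover have "4 * X \<in> \<int>" unfolding X_def by (intro Ints_mult Suc) auto
  ultimately show ?case using Suc[of "Suc k"] by (metis Ints_diff)
qed

text \<open>The quotient is the super Catalan number \<open>S(k, n - k)\<close>.\<close>

lemma binomial_dvd_central_binomials: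
  assumes "k \<le> n"
  shows "(n choose k) dvd ((2 * k) choose k) * ((2 * (n - k)) choose (n - k))"
proof -
  define l where "l = n - k"
  have n: "n = k + l" using assms by (simp add: l_def)
  have c: "real (2 * j choose j) = fact (2 * j) / (fact j * fact j)" for j
    by (subst binomial_fact) auto
  have "real (n choose k) = fact (k + l) / (fact k * fact l)"
    by (subst binomial_fact) (auto simp: n)
  then have eq: "real ((2 * k choose k) * (2 * l choose l)) = real (n choose k) *
      (fact (2 * k) * fact (2 * l) / (fact k * fact l * fact (k + l)))"
    by (simp add: c)
  obtain z where "fact (2 * k) * fact (2 * l) / (fact k * fact l * fact (k + l)) = real_of_int z"
    using super_catalan_Ints Ints_cases by metis
  with eq have "of_int (int ((2 * k choose k) * (2 * l choose l))) = (of_int (int (n choose k) * z) :: real)"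
    by simp
  then have "int ((2 * k choose k) * (2 * l choose l)) = int (n choose k) * z"
    by (simp only: of_int_eq_iff)
  then have "int (n choose k) dvd int ((2 * k choose k) * (2 * l choose l))" by simp
  then show ?thesis by (simp only: int_dvd_int_iff l_def)
qed

section \<open>Divisibility and congruences of the summands\<close>

definition domb_term :: "nat \<Rightarrow> nat \<Rightarrow> nat \<Rightarrow> nat \<Rightarrow> nat \<Rightarrow> nat" where
  "domb_term A B C n k =
     (n choose k) ^ A * ((2 * k) choose k) ^ B * ((2 * (n - k)) choose (n - k)) ^ C"

lemma binomial_cube_dvd_domb_term:
  assumes "A \<ge> 2" "B \<ge> 1" "C \<ge> 1" "k \<le> n"
  shows "(n choose k) ^ 3 dvd domb_term A B C n k"
proof -
  let ?b = "(2 * k) choose k" and ?c = "(2 * (n - k)) choose (n - k)"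
  have "(n choose k) ^ 3 = (n choose k) ^ 2 * (n choose k)"
    by (simp add: power3_eq_cube power2_eq_square)
  also have "\<dots> dvd (n choose k) ^ A * (?b * ?c)"
    using assms by (intro mult_dvd_mono le_imp_power_dvd binomial_dvd_central_binomials) auto
  also have "\<dots> dvd (n choose k) ^ A * (?b ^ B * ?c ^ C)"
    using assms by (intro mult_dvd_mono dvd_power) auto
  finally show ?thesis by (simp add: domb_term_def mult.assoc)
qed

text \<open>Take for \<open>s\<close> the exponent of \<open>p\<close> in \<open>k\<close>, capped
  at \<open>R\<close>. By absorption \<open>p ^ R\<close> divides \<open>k * (n choose k)\<close>,
  and \<open>k\<close> accounts for only \<open>p ^ s\<close> of it.\<close>

lemma prime_power_dvd_binomial:
  fixes p :: nat
  assumes p: "prime p" and n: "p ^ R dvd n"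
  shows "\<exists>s\<le>R. p ^ s dvd k \<and> p ^ (R - s) dvd (n choose k)"
proof (cases "p ^ R dvd k")
  case False
  then have k: "k \<noteq> 0" by (intro notI) simp
  have "\<not> is_unit p" using p by auto
  with k obtain j where j: "k = p ^ multiplicity p k * j" "\<not> p dvd j"
    using multiplicity_decompose' by metis
  define s where "s = multiplicity p k"
  have s: "s < R"
  proof (rule ccontr)
    assume "\<not> s < R"
    then have "p ^ R dvd p ^ s" by (simp add: le_imp_power_dvd)
    then show False using False j s_def by (metis dvd_mult2)
  qed
  have "k * (n choose k) = n * ((n - 1) choose (k - 1))"
    using k binomial_absorption[of "k - 1" "n"] by simp
  moreover have "p ^ R = p ^ s * p ^ (R - s)" using s by (simp add: power_add[symmetric])
  ultimately have "p ^ s * p ^ (R - s) dvd p ^ s * (j * (n choose k))"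
    using n j(1) by (metis dvd_mult2 mult.assoc s_def)
  then have "p ^ (R - s) dvd j * (n choose k)" using p by simp
  moreover have "coprime (p ^ (R - s)) j" using p j by (simp add: prime_imp_coprime)
  ultimately have "p ^ (R - s) dvd (n choose k)" using coprime_dvd_mult_right_iff by blast
  moreover have "p ^ s dvd k" using j(1) s_def by (metis dvd_triv_left)
  ultimately show ?thesis using s less_imp_le by blast
qed auto

lemma domb_term_not_dvd:
  assumes "A \<ge> 2" "B \<ge> 1" "C \<ge> 1" and p: "prime p" and n: "p ^ r dvd n"
    and k: "k \<le> n" "\<not> p dvd k"
  shows "p ^ (3 * r) dvd domb_term A B C n k"
proof -
  obtain s where s: "s \<le> r" "p ^ s dvd k" "p ^ (r - s) dvd (n choose k)"
    using prime_power_dvd_binomial[OF p n] by blast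
  \<comment> \<open>A positive \<open>s\<close> would make \<open>p\<close> divide
    \<open>k\<close>.\<close>
  then have "s = 0" using k by (metis dvd_power dvd_trans gr0I)
  with s have "(p ^ r) ^ 3 dvd (n choose k) ^ 3" by (simp add: dvd_power_same)
  also have "\<dots> dvd domb_term A B C n k" using assms by (intro binomial_cube_dvd_domb_term)
  finally show ?thesis by (simp add: power_mult[symmetric] mult.commute)
qed

lemma domb_term_mult_cong:
  fixes p n k r :: nat
  assumes ABC: "A \<ge> 2" "B \<ge> 1" "C \<ge> 1" and p: "prime p" "p > 3"
    and n: "p ^ r dvd n" and k: "k \<le> n"
  shows "[int (domb_term A B C (p * n) (p * k)) = int (domb_term A B C n k)] (mod int p ^ (3 * Suc r))"
proof -
  obtain s where s: "s \<le> r" "p ^ s dvd k" "p ^ (r - s) dvd (n choose k)"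
    using prime_power_dvd_binomial[OF p(1) n] by blast
  \<comment> \<open>The exponent exceeds \<open>s\<close> by one because the multiples
    \<open>p * n\<close> and \<open>p * k\<close> carry one more factor \<open>p\<close>. The ratio
    thus gives \<open>3 * (s + 1)\<close> and the cube in the summand \<open>3 * (r - s)\<close>, in
    total \<open>3 * (r + 1)\<close>.\<close>
  let ?e = "Suc s"
  have "p ^ s dvd n" using n s by (meson dvd_trans le_imp_power_dvd)
  then have dn: "p ^ ?e dvd p * n" by simp
  have dk: "p ^ ?e dvd p * k" using s by simp
  have central: "ratio_cong_1 p (3 * ?e) (int (2 * (p * j) choose (p * j))) (int (2 * j choose j))"
    if "p ^ ?e dvd p * j" for j
  proof -
    have "p ^ ?e dvd p * (2 * j)" using that by (metis dvd_mult mult.left_commute)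
    then show ?thesis
      using binomial_ratio_cong_1[OF p, of ?e "2 * j" j] that by (simp add: mult.left_commute)
  qed
  have "p ^ ?e dvd p * (n - k)"
    using dn dk by (metis diff_mult_distrib2 dvd_diff_nat)
  then have "ratio_cong_1 p (3 * ?e) (int (domb_term A B C (p * n) (p * k))) (int (domb_term A B C n k))"
    unfolding domb_term_def of_nat_mult of_nat_power diff_mult_distrib2[symmetric]
    using dn dk k
    by (intro ratio_cong_1_mult ratio_cong_1_power central binomial_ratio_cong_1[OF p]) auto
  moreover have "int p ^ (3 * (r - s)) dvd int (domb_term A B C n k)"
  proof -
    have "(p ^ (r - s)) ^ 3 dvd (n choose k) ^ 3" using s by (simp add: dvd_power_same)
    also have "\<dots> dvd domb_term A B C n k" using ABC k by (intro binomial_cube_dvd_domb_term)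
    finally have "p ^ (3 * (r - s)) dvd domb_term A B C n k"
      by (simp add: power_mult[symmetric] mult.commute)
    then show ?thesis by (metis int_dvd_int_iff of_nat_power)
  qed
  ultimately have "[int (domb_term A B C (p * n) (p * k)) = int (domb_term A B C n k)]
      (mod int p ^ (3 * (r - s) + 3 * ?e))"
    by (rule ratio_cong_1_imp_cong)
  moreover have "3 * (r - s) + 3 * ?e = 3 * Suc r" using s by simp
  ultimately show ?thesis by (simp only:)
qed

theorem theorem1p1:
  fixes A B C p m r :: nat
  assumes "A \<ge> 2" and "B \<ge> 1" and "C \<ge> 1"
    and "prime p" and "p > 3"
    and "m \<ge> 1" and "r \<ge> 1"
  shows "[gen_domb (m * p ^ r) A B C = gen_domb (m * p ^ (r - 1)) A B C] (mod p ^ (3 * r))"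
proof -
  obtain R where r: "r = Suc R" using \<open>r \<ge> 1\<close> by (cases r) auto
  define n where "n = m * p ^ R"
  have p0: "p > 0" using \<open>p > 3\<close> by simp
  have N: "m * p ^ r = p * n" by (simp add: r n_def mult_ac)
  let ?T = "domb_term A B C"
  have D: "gen_domb N A B C = (\<Sum>k\<in>{0..N}. ?T N k)" for N
    by (simp add: gen_domb_def domb_term_def)
  have eq: "{0..p * n} = (*) p ` {0..n} \<union> {k\<in>{0..p * n}. \<not> p dvd k}"
    using p0 by (auto simp: image_iff)
  have "gen_domb (p * n) A B C =
      (\<Sum>k\<in>(*) p ` {0..n}. ?T (p * n) k) + (\<Sum>k\<in>{k\<in>{0..p * n}. \<not> p dvd k}. ?T (p * n) k)"
    unfolding D by (subst eq, rule sum.union_disjoint) auto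
  also have "(\<Sum>k\<in>(*) p ` {0..n}. ?T (p * n) k) = (\<Sum>k\<in>{0..n}. ?T (p * n) (p * k))"
    using p0 by (subst sum.reindex) (auto simp: inj_on_def)
  also have "[\<dots> + (\<Sum>k\<in>{k\<in>{0..p * n}. \<not> p dvd k}. ?T (p * n) k) = gen_domb n A B C + 0] (mod p ^ (3 * r))"
  proof (rule cong_add)
    have "[?T (p * n) (p * k) = ?T n k] (mod p ^ (3 * r))" if "k \<in> {0..n}" for k
      using domb_term_mult_cong[of A B C p R n k] assms that
      by (simp add: r n_def cong_int_iff flip: of_nat_power)
    then show "[(\<Sum>k\<in>{0..n}. ?T (p * n) (p * k)) = gen_domb n A B C] (mod p ^ (3 * r))"
      unfolding D by (rule cong_sum)
    \<comment> \<open>The summands with \<open>k\<close> prime to \<open>p\<close> belong to the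
      larger index \<open>p * n\<close>, which has the full power \<open>p ^ r\<close>; for
      \<open>n\<close> only \<open>p ^ R\<close> with \<open>R = r - 1\<close> is available.\<close>
    have "p ^ r dvd p * n" by (simp add: r n_def)
    then have "p ^ (3 * r) dvd ?T (p * n) k" if "k \<in> {k\<in>{0..p * n}. \<not> p dvd k}" for k
      using assms that by (intro domb_term_not_dvd) auto
    then show "[(\<Sum>k\<in>{k\<in>{0..p * n}. \<not> p dvd k}. ?T (p * n) k) = 0] (mod p ^ (3 * r))"
      by (simp only: cong_0_iff) (rule dvd_sum)
  qed
  finally show ?thesis unfolding N by (simp add: r n_def)
qed

end
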